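(* The pair $(L_{(123)},L_{(132)})$ belongs to $OLS_3$, and every element of $OLS_3$ is $\sim'$-equivalent to $(L_{(123)},L_{(132)})$; i.e. $OLS_3/\sim'$ has exactly one element.
   Context: A Latin square of size $k$ is a $k\times k$ array with entries in $\{1,\dots,k\}$ with no repetition in any row or column. For a $k$-cycle $\sigma\in\text{Sym}_k$, $L_\sigma$ denotes the Latin square whose first row is $(1,2,\dots,k)$ and whose row $i+1$ is obtained by applying $\sigma$ entrywise to row $i$. Two Latin squares $L,L'$ are orthogonal if $(i,j)\mapsto(L_{ij},L'_{ij})$ is a bijection of $\{1,\dots,k\}^2$; $OLS_k$ is the set of ordered orthogonal pairs of size $k$. $(L_1,L_2)\sim'(L_1',L_2')$ means one can pass from one pair to the other by a finite sequence of: (R1) exchange rows $i$ and $j$ in both squares; (R2) exchange columns $i$ and $j$ in both squares; (R3) exchange two symbols in the first square; (R4) exchange two symbols in the second square; (R5) transpose one of the squares; (R6) swap the two squares. *)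

theory Defs
  imports "HOL-Library.FuncSet" "HOL-Combinatorics.Combinatorics"
begin

text \<open>
  A \<open>k \<times> k\<close> array is a function on index pairs (row, column); it is extensional,
  so that equality of functions is equality of arrays.
\<close>

type_synonym square = "nat \<times> nat \<Rightarrow> nat"

definition cells :: "nat \<Rightarrow> (nat \<times> nat) set" where
  "cells k = {1..k} \<times> {1..k}"

definition latin_squares :: "nat \<Rightarrow> square set" where
  "latin_squares k = {L \<in> cells k \<rightarrow>\<^sub>E {1..k}.
     (\<forall>i\<in>{1..k}. inj_on (\<lambda>j. L (i, j)) {1..k}) \<and>
     (\<forall>j\<in>{1..k}. inj_on (\<lambda>i. L (i, j)) {1..k})}"

definition cyclic_square :: "nat \<Rightarrow> (nat \<Rightarrow> nat) \<Rightarrow> square" where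
  "cyclic_square k \<sigma> = (\<lambda>(i, j)\<in>cells k. (\<sigma> ^^ (i - 1)) j)"

definition orthogonal_squares :: "nat \<Rightarrow> square \<Rightarrow> square \<Rightarrow> bool" where
  "orthogonal_squares k L L' \<longleftrightarrow> bij_betw (\<lambda>c. (L c, L' c)) (cells k) ({1..k} \<times> {1..k})"

definition OLS :: "nat \<Rightarrow> (square \<times> square) set" where
  "OLS k = {(L, L'). L \<in> latin_squares k \<and> L' \<in> latin_squares k \<and> orthogonal_squares k L L'}"

definition swap_rows :: "nat \<Rightarrow> nat \<Rightarrow> nat \<Rightarrow> square \<Rightarrow> square" where
  "swap_rows k a b L = (\<lambda>(i, j)\<in>cells k. L (Transposition.transpose a b i, j))"

definition swap_cols :: "nat \<Rightarrow> nat \<Rightarrow> nat \<Rightarrow> square \<Rightarrow> square" where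
  "swap_cols k a b L = (\<lambda>(i, j)\<in>cells k. L (i, Transposition.transpose a b j))"

definition swap_symbols :: "nat \<Rightarrow> nat \<Rightarrow> nat \<Rightarrow> square \<Rightarrow> square" where
  "swap_symbols k a b L = (\<lambda>c\<in>cells k. Transposition.transpose a b (L c))"

definition transpose_square :: "nat \<Rightarrow> square \<Rightarrow> square" where
  "transpose_square k L = (\<lambda>(i, j)\<in>cells k. L (j, i))"

inductive ols_move :: "nat \<Rightarrow> square \<times> square \<Rightarrow> square \<times> square \<Rightarrow> bool" for k :: nat where
  R1: "a \<in> {1..k} \<Longrightarrow> b \<in> {1..k} \<Longrightarrow>
        ols_move k (L, L') (swap_rows k a b L, swap_rows k a b L')"
| R2: "a \<in> {1..k} \<Longrightarrow> b \<in> {1..k} \<Longrightarrow>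
        ols_move k (L, L') (swap_cols k a b L, swap_cols k a b L')"
| R3: "a \<in> {1..k} \<Longrightarrow> b \<in> {1..k} \<Longrightarrow> ols_move k (L, L') (swap_symbols k a b L, L')"
| R4: "a \<in> {1..k} \<Longrightarrow> b \<in> {1..k} \<Longrightarrow> ols_move k (L, L') (L, swap_symbols k a b L')"
| R5_first: "ols_move k (L, L') (transpose_square k L, L')"
| R5_second: "ols_move k (L, L') (L, transpose_square k L')"
| R6: "ols_move k (L, L') (L', L)"

text \<open>
  Transposing a single square of an orthogonal pair can destroy orthogonality.
  The relation lives on \<open>OLS k\<close>, so all intermediate pairs of a
  sequence of moves are required to be in \<open>OLS k\<close>.
\<close>

definition ols_equiv :: "nat \<Rightarrow> ((square \<times> square) \<times> (square \<times> square)) set" where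
  "ols_equiv k = Restr ((Restr {(p, q). ols_move k p q} (OLS k))\<^sup>*) (OLS k)"

lemma latin_square_ext:
  assumes "L \<in> latin_squares k"
  shows "L \<in> extensional (cells k)"
  using assms by (auto simp: latin_squares_def PiE_def)

lemma transpose_mem:
  assumes "a \<in> {1..k}" "b \<in> {1..k}" "i \<in> {1..k}"
  shows "Transposition.transpose a b i \<in> {1..k}"
  using assms by (auto simp: Transposition.transpose_def)

lemma moves_involutive:
  assumes "L \<in> extensional (cells k)"
  shows "a \<in> {1..k} \<Longrightarrow> b \<in> {1..k} \<Longrightarrow> swap_rows k a b (swap_rows k a b L) = L"
    and "a \<in> {1..k} \<Longrightarrow> b \<in> {1..k} \<Longrightarrow> swap_cols k a b (swap_cols k a b L) = L"
    and "swap_symbols k a b (swap_symbols k a b L) = L"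
    and "transpose_square k (transpose_square k L) = L"
  using assms transpose_mem[of a k b]
  by (auto intro!: extensionalityI[OF _ assms] simp: swap_rows_def swap_cols_def
      swap_symbols_def transpose_square_def cells_def simp del: atLeastAtMost_iff)

lemma ols_move_sym:
  assumes "ols_move k p q" "p \<in> OLS k"
  shows "ols_move k q p"
proof -
  have "fst p \<in> extensional (cells k)" "snd p \<in> extensional (cells k)"
    using assms(2) by (auto simp: OLS_def intro: latin_square_ext)
  with assms(1) show ?thesis
    by cases (metis fst_conv snd_conv moves_involutive ols_move.intros)+
qed

lemma equiv_ols_equiv: "equiv (OLS k) (ols_equiv k)"
proof -
  have "sym (Restr {(p, q). ols_move k p q} (OLS k))"
    by (auto intro!: symI dest: ols_move_sym)
  then have "sym ((Restr {(p, q). ols_move k p q} (OLS k))\<^sup>*)"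
    by (rule sym_rtrancl)
  then show ?thesis
    unfolding ols_equiv_def
    by (intro equivI) (auto simp: refl_on_def sym_def intro!: transI intro: rtrancl_trans)
qed

end

theory Submission
  imports Defs
begin

text \<open>
  Permuting symbols turns the first row of each square into \<open>(1, 2, 3)\<close>, and exchanging
  rows 2 and 3 if necessary turns the first column of the first square into
  \<open>(1, 2, 3)\<close>. The first square is then determined. The first rows already produce all pairs
  \<open>(s, s)\<close>, so by orthogonality the squares disagree at every cell below the first row,
  which determines the second square as well.
\<close>

section \<open>Latin squares and their preservation under symbol and row exchanges\<close>

lemma latin_squareI:
  assumes "L \<in> extensional (cells k)"
    and "\<And>i j. i \<in> {1..k} \<Longrightarrow> j \<in> {1..k} \<Longrightarrow> L (i, j) \<in> {1..k}"
    and "\<And>i. i \<in> {1..k} \<Longrightarrow> inj_on (\<lambda>j. L (i, j)) {1..k}"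
    and "\<And>j. j \<in> {1..k} \<Longrightarrow> inj_on (\<lambda>i. L (i, j)) {1..k}"
  shows "L \<in> latin_squares k"
  using assms by (auto simp: latin_squares_def PiE_def cells_def simp del: atLeastAtMost_iff)

lemma latin_square_mem:
  assumes "L \<in> latin_squares k" "i \<in> {1..k}" "j \<in> {1..k}"
  shows "L (i, j) \<in> {1..k}"
proof -
  have "L \<in> cells k \<rightarrow>\<^sub>E {1..k}"
    using assms(1) unfolding latin_squares_def by blast
  then show ?thesis
    by (rule PiE_mem) (use assms(2,3) in \<open>simp add: cells_def\<close>)
qed

lemma latin_square_row_eq_iff:
  assumes "L \<in> latin_squares k" "i \<in> {1..k}" "j \<in> {1..k}" "j' \<in> {1..k}"
  shows "L (i, j) = L (i, j') \<longleftrightarrow> j = j'"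
proof -
  have "inj_on (\<lambda>j. L (i, j)) {1..k}"
    using assms(1,2) unfolding latin_squares_def by blast
  from inj_on_eq_iff[OF this assms(3,4)] show ?thesis .
qed

lemma latin_square_col_eq_iff:
  assumes "L \<in> latin_squares k" "i \<in> {1..k}" "i' \<in> {1..k}" "j \<in> {1..k}"
  shows "L (i, j) = L (i', j) \<longleftrightarrow> i = i'"
proof -
  have "inj_on (\<lambda>i. L (i, j)) {1..k}"
    using assms(1,4) unfolding latin_squares_def by blast
  from inj_on_eq_iff[OF this assms(2,3)] show ?thesis .
qed

lemma swap_symbols_apply:
  assumes "i \<in> {1..k}" "j \<in> {1..k}"
  shows "swap_symbols k a b L (i, j) = Transposition.transpose a b (L (i, j))"
  using assms by (simp add: swap_symbols_def cells_def)

lemma swap_rows_apply: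
  assumes "i \<in> {1..k}" "j \<in> {1..k}"
  shows "swap_rows k a b L (i, j) = L (Transposition.transpose a b i, j)"
  using assms by (simp add: swap_rows_def cells_def)

lemma swap_symbols_latin:
  assumes L: "L \<in> latin_squares k" and ab: "a \<in> {1..k}" "b \<in> {1..k}"
  shows "swap_symbols k a b L \<in> latin_squares k"
proof (rule latin_squareI)
  note simps = swap_symbols_apply inj_eq[OF inj_transpose] transpose_mem[OF ab]
    latin_square_row_eq_iff[OF L] latin_square_col_eq_iff[OF L]
  show "swap_symbols k a b L \<in> extensional (cells k)"
    by (simp add: swap_symbols_def)
  show "swap_symbols k a b L (i, j) \<in> {1..k}" if "i \<in> {1..k}" "j \<in> {1..k}" for i j
    unfolding swap_symbols_apply[OF that] by (intro transpose_mem[OF ab] latin_square_mem[OF L] that)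
  show "inj_on (\<lambda>j. swap_symbols k a b L (i, j)) {1..k}" if "i \<in> {1..k}" for i
    by (rule inj_onI) (use that in \<open>simp add: simps del: atLeastAtMost_iff One_nat_def\<close>)
  show "inj_on (\<lambda>i. swap_symbols k a b L (i, j)) {1..k}" if "j \<in> {1..k}" for j
    by (rule inj_onI) (use that in \<open>simp add: simps del: atLeastAtMost_iff One_nat_def\<close>)
qed

lemma swap_rows_latin:
  assumes L: "L \<in> latin_squares k" and ab: "a \<in> {1..k}" "b \<in> {1..k}"
  shows "swap_rows k a b L \<in> latin_squares k"
proof (rule latin_squareI)
  note simps = swap_rows_apply inj_eq[OF inj_transpose] transpose_mem[OF ab]
    latin_square_row_eq_iff[OF L] latin_square_col_eq_iff[OF L]
  show "swap_rows k a b L \<in> extensional (cells k)"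
    by (simp add: swap_rows_def)
  show "swap_rows k a b L (i, j) \<in> {1..k}" if "i \<in> {1..k}" "j \<in> {1..k}" for i j
    unfolding swap_rows_apply[OF that] by (intro latin_square_mem[OF L] transpose_mem[OF ab] that)
  show "inj_on (\<lambda>j. swap_rows k a b L (i, j)) {1..k}" if "i \<in> {1..k}" for i
    by (rule inj_onI) (use that in \<open>simp add: simps del: atLeastAtMost_iff One_nat_def\<close>)
  show "inj_on (\<lambda>i. swap_rows k a b L (i, j)) {1..k}" if "j \<in> {1..k}" for j
    by (rule inj_onI) (use that in \<open>simp add: simps del: atLeastAtMost_iff One_nat_def\<close>)
qed

section \<open>Preservation of orthogonality\<close>

lemma bij_betw_transpose:
  assumes "a \<in> A" "b \<in> A"
  shows "bij_betw (Transposition.transpose a b) A A"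
  using assms by (auto intro!: bij_betwI[where g = "Transposition.transpose a b"]
      simp: Transposition.transpose_def)

text \<open>Exchanging symbols composes the pairing map, on the value side, with a permutation of
  the first coordinate.\<close>

lemma orthogonal_swap_symbols:
  assumes "orthogonal_squares k L L'" "a \<in> {1..k}" "b \<in> {1..k}"
  shows "orthogonal_squares k (swap_symbols k a b L) L'"
proof -
  have "bij_betw (map_prod (Transposition.transpose a b) id)
      ({1..k} \<times> {1..k}) ({1..k} \<times> {1..k})"
    by (intro bij_betw_map_prod bij_betw_transpose bij_betw_id assms)
  from bij_betw_trans[OF assms(1)[unfolded orthogonal_squares_def] this]
  show ?thesis
    unfolding orthogonal_squares_def
    \<comment> \<open>The composite and the new pairing map need only agree on
      \<open>cells k\<close>; outside it \<open>swap_symbols\<close> takes the default value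
      \<open>undefined\<close>.\<close>
    by (rule bij_betw_cong[THEN iffD1, rotated]) (simp add: swap_symbols_def)
qed

text \<open>Here the composition is on the argument side: both squares are read through the same
  permutation of the cells.\<close>

lemma orthogonal_swap_rows:
  assumes "orthogonal_squares k L L'" "a \<in> {1..k}" "b \<in> {1..k}"
  shows "orthogonal_squares k (swap_rows k a b L) (swap_rows k a b L')"
proof -
  have "bij_betw (map_prod (Transposition.transpose a b) id) (cells k) (cells k)"
    unfolding cells_def by (intro bij_betw_map_prod bij_betw_transpose bij_betw_id assms)
  from bij_betw_trans[OF this assms(1)[unfolded orthogonal_squares_def]]
  show ?thesis
    unfolding orthogonal_squares_def
    by (rule bij_betw_cong[THEN iffD1, rotated]) (auto simp: swap_rows_def)
qed

lemma orthogonal_squares_sym: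
  assumes "orthogonal_squares k L L'"
  shows "orthogonal_squares k L' L"
proof -
  have "bij_betw prod.swap ({1..k} \<times> {1..k}) ({1..k} \<times> {1..k})"
    by (rule bij_betwI[where g = prod.swap]) auto
  from bij_betw_trans[OF assms[unfolded orthogonal_squares_def] this]
  show ?thesis
    unfolding orthogonal_squares_def by (simp add: comp_def)
qed

section \<open>Single moves as steps of the equivalence\<close>

text \<open>Since \<open>ols_equiv\<close> admits only pairs in \<open>OLS k\<close>, a move counts
  as a step once both of its ends lie there. Each equivalence by a single move thus reduces to
  preservation of \<open>OLS k\<close>.\<close>

lemma ols_equiv_if_move:
  assumes "ols_move k p q" "p \<in> OLS k" "q \<in> OLS k"
  shows "(p, q) \<in> ols_equiv k"
  using assms by (auto simp: ols_equiv_def)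

lemma ols_equiv_trans:
  assumes "(p, q) \<in> ols_equiv k" "(q, r) \<in> ols_equiv k"
  shows "(p, r) \<in> ols_equiv k"
  using equiv_ols_equiv[of k] assms by (meson equivE transD)

lemma ols_equiv_mem:
  assumes "(p, q) \<in> ols_equiv k"
  shows "q \<in> OLS k"
  using assms by (simp add: ols_equiv_def)

lemma ols_equiv_swap:
  assumes "(L, L') \<in> OLS k"
  shows "((L, L'), (L', L)) \<in> ols_equiv k"
  using assms by (intro ols_equiv_if_move ols_move.R6)
    (auto simp: OLS_def intro: orthogonal_squares_sym)

lemma ols_equiv_swap_symbols:
  assumes "(L, L') \<in> OLS k" "a \<in> {1..k}" "b \<in> {1..k}"
  shows "((L, L'), (swap_symbols k a b L, L')) \<in> ols_equiv k"
  using assms by (intro ols_equiv_if_move ols_move.R3)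
    (auto simp: OLS_def intro: orthogonal_swap_symbols swap_symbols_latin
      simp del: atLeastAtMost_iff)

lemma ols_equiv_swap_rows:
  assumes "(L, L') \<in> OLS k" "a \<in> {1..k}" "b \<in> {1..k}"
  shows "((L, L'), (swap_rows k a b L, swap_rows k a b L')) \<in> ols_equiv k"
  using assms by (intro ols_equiv_if_move ols_move.R1)
    (auto simp: OLS_def intro: orthogonal_swap_rows swap_rows_latin
      simp del: atLeastAtMost_iff)

section \<open>Normalizing the first rows\<close>

text \<open>Induction on \<open>m\<close>, fixing one more column by one symbol exchange each time.
  The second square stays untouched, so a first row already normalized there survives.\<close>

lemma normalize_first_row_upto:
  assumes "(L, L') \<in> OLS k" "m \<le> k"
  shows "\<exists>M. ((L, L'), (M, L')) \<in> ols_equiv k \<and> (\<forall>j\<in>{1..m}. M (1, j) = j)"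
  using assms(2)
proof (induction m)
  case 0
  show ?case
    using equiv_ols_equiv[of k] assms(1) by (auto elim!: equivE dest: refl_onD)
next
  case (Suc m)
  then obtain M where M: "((L, L'), (M, L')) \<in> ols_equiv k" "\<forall>j\<in>{1..m}. M (1, j) = j"
    by auto
  let ?a = "M (1, Suc m)"
  \<comment> \<open>This sends the entry in column \<open>Suc m\<close> to \<open>Suc m\<close>.
    Earlier columns keep their entries: these are at most \<open>m\<close>, and they differ from
    \<open>?a\<close> because a row has no repetition.\<close>
  let ?N = "swap_symbols k ?a (Suc m) M"
  have MO: "(M, L') \<in> OLS k" and latin: "M \<in> latin_squares k"
    using ols_equiv_mem[OF M(1)] by (auto simp: OLS_def)
  have a: "?a \<in> {1..k}"
    using latin_square_mem[OF latin] Suc.prems by simp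
  have "?N (1, j) = j" if j: "j \<in> {1..Suc m}" for j
  proof (cases "j = Suc m")
    case True
    then show ?thesis using Suc.prems by (simp add: swap_symbols_apply)
  next
    case False
    with j have "M (1, j) = j" using M(2) by simp
    moreover have "M (1, j) \<noteq> ?a"
      using latin_square_row_eq_iff[OF latin, of 1 j "Suc m"] j False Suc.prems by auto
    ultimately show ?thesis
      using j False Suc.prems
      by (subst swap_symbols_apply) (auto simp: Transposition.transpose_def)
  qed
  moreover have "((L, L'), (?N, L')) \<in> ols_equiv k"
    using ols_equiv_trans[OF M(1) ols_equiv_swap_symbols[OF MO a]] Suc.prems by simp
  ultimately show ?case by blast
qed

text \<open>Normalize the first square, swap the two, and normalize what is now the first
  square.\<close>

lemma normalize_first_rows:
  assumes "(L, L') \<in> OLS k"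
  shows "\<exists>M M'. ((L, L'), (M, M')) \<in> ols_equiv k \<and>
    (\<forall>j\<in>{1..k}. M (1, j) = j) \<and> (\<forall>j\<in>{1..k}. M' (1, j) = j)"
proof -
  obtain M where M: "((L, L'), (M, L')) \<in> ols_equiv k" "\<forall>j\<in>{1..k}. M (1, j) = j"
    using normalize_first_row_upto[OF assms] by blast
  have sw: "((M, L'), (L', M)) \<in> ols_equiv k"
    by (rule ols_equiv_swap[OF ols_equiv_mem[OF M(1)]])
  obtain M' where M': "((L', M), (M', M)) \<in> ols_equiv k" "\<forall>j\<in>{1..k}. M' (1, j) = j"
    using normalize_first_row_upto[OF ols_equiv_mem[OF sw]] by blast
  \<comment> \<open>The pair comes out in reversed order, which is harmless because the condition on
    the two first rows is symmetric.\<close>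
  have "((L, L'), (M', M)) \<in> ols_equiv k"
    using M(1) sw M'(1) by (blast intro: ols_equiv_trans)
  with M(2) M'(2) show ?thesis by blast
qed

text \<open>The pair \<open>(s, s)\<close> already occurs at cell \<open>(1, s)\<close>, and
  orthogonality lets it occur only once.\<close>

lemma orthogonal_normalized_disagree:
  assumes "(L, L') \<in> OLS k" "\<forall>j\<in>{1..k}. L (1, j) = j" "\<forall>j\<in>{1..k}. L' (1, j) = j"
    and "i \<in> {1..k}" "j \<in> {1..k}" "i \<noteq> 1"
  shows "L (i, j) \<noteq> L' (i, j)"
proof
  assume eq: "L (i, j) = L' (i, j)"
  have s: "L (i, j) \<in> {1..k}"
    using assms(1) latin_square_mem[OF _ assms(4,5), of L] by (simp add: OLS_def)
  have "inj_on (\<lambda>c. (L c, L' c)) (cells k)"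
    using assms(1) by (auto simp: OLS_def orthogonal_squares_def bij_betw_def)
  \<comment> \<open>The common symbol serves as a column index: in row 1, column \<open>s\<close>
    holds \<open>s\<close> in both squares.\<close>
  moreover have "(L (i, j), L' (i, j)) = (L (1, L (i, j)), L' (1, L (i, j)))"
    using assms s eq by simp
  ultimately have "(i, j) = (1, L (i, j))"
    by (rule inj_onD) (use assms s in \<open>auto simp: cells_def\<close>)
  with \<open>i \<noteq> 1\<close> show False by simp
qed

section \<open>The two cyclic squares of order three\<close>

lemma atLeastAtMost_1_3: "{1..3::nat} = {1, 2, 3}"
  by auto

text \<open>The rows are the powers of the 3-cycle: 123, 231, 312.\<close>

lemma cyclic_square_123:
  "cyclic_square 3 (cycle_of_list [1, 2, 3]) \<in> extensional (cells 3)"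
  "\<And>j. j \<in> {1..3} \<Longrightarrow> cyclic_square 3 (cycle_of_list [1, 2, 3]) (1, j) = j"
  "cyclic_square 3 (cycle_of_list [1, 2, 3]) (2, 1) = 2"
  "cyclic_square 3 (cycle_of_list [1, 2, 3]) (2, 2) = 3"
  "cyclic_square 3 (cycle_of_list [1, 2, 3]) (2, 3) = 1"
  "cyclic_square 3 (cycle_of_list [1, 2, 3]) (3, 1) = 3"
  "cyclic_square 3 (cycle_of_list [1, 2, 3]) (3, 2) = 1"
  "cyclic_square 3 (cycle_of_list [1, 2, 3]) (3, 3) = 2"
  \<comment> \<open>Rewriting numerals to \<open>Suc\<close> form lets the iterates of the cycle
    unfold.\<close>
  by (simp_all add: cyclic_square_def cells_def numeral_2_eq_2 numeral_3_eq_3)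

text \<open>This cycle is the inverse of the previous one, so the last two rows appear in the other
  order: 123, 312, 231.\<close>

lemma cyclic_square_132:
  "cyclic_square 3 (cycle_of_list [1, 3, 2]) \<in> extensional (cells 3)"
  "\<And>j. j \<in> {1..3} \<Longrightarrow> cyclic_square 3 (cycle_of_list [1, 3, 2]) (1, j) = j"
  "cyclic_square 3 (cycle_of_list [1, 3, 2]) (2, 1) = 3"
  "cyclic_square 3 (cycle_of_list [1, 3, 2]) (2, 2) = 1"
  "cyclic_square 3 (cycle_of_list [1, 3, 2]) (2, 3) = 2"
  "cyclic_square 3 (cycle_of_list [1, 3, 2]) (3, 1) = 2"
  "cyclic_square 3 (cycle_of_list [1, 3, 2]) (3, 2) = 3"
  "cyclic_square 3 (cycle_of_list [1, 3, 2]) (3, 3) = 1"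
  by (simp_all add: cyclic_square_def cells_def numeral_2_eq_2 numeral_3_eq_3)

lemma cyclic_pair_in_OLS:
  "(cyclic_square 3 (cycle_of_list [1, 2, 3]), cyclic_square 3 (cycle_of_list [1, 3, 2])) \<in> OLS 3"
proof -
  define A where "A = cyclic_square 3 (cycle_of_list [1, 2, 3])"
  define B where "B = cyclic_square 3 (cycle_of_list [1, 3, 2])"
  note ext = cyclic_square_123(1)[folded A_def] cyclic_square_132(1)[folded B_def]
  note A = cyclic_square_123(2-)[folded A_def] and B = cyclic_square_132(2-)[folded B_def]
  have first: "A (1, 1) = 1" "A (1, 2) = 2" "A (1, 3) = 3" "B (1, 1) = 1" "B (1, 2) = 2" "B (1, 3) = 3"
    by (simp_all add: A(1) B(1) del: One_nat_def)
  note val = first A(2-) B(2-)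
  have "A \<in> latin_squares 3"
    by (rule latin_squareI[OF ext(1)], unfold atLeastAtMost_1_3)
      (auto simp: val simp del: One_nat_def)
  moreover have "B \<in> latin_squares 3"
    by (rule latin_squareI[OF ext(2)], unfold atLeastAtMost_1_3)
      (auto simp: val simp del: One_nat_def)
  moreover have "orthogonal_squares 3 A B"
  proof -
    have cells: "cells 3 = {(1,1), (1,2), (1,3), (2,1), (2,2), (2,3), (3,1), (3,2), (3,3)}"
      unfolding cells_def atLeastAtMost_1_3 by auto
    have img: "(\<lambda>c. (A c, B c)) ` cells 3 = {1..3} \<times> {1..3}"
      unfolding cells unfolding atLeastAtMost_1_3
      by (simp add: val insert_commute del: One_nat_def)
    \<comment> \<open>Nine cells map onto nine pairs, so surjectivity forces injectivity.\<close>
    then have "inj_on (\<lambda>c. (A c, B c)) (cells 3)"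
      by (intro eq_card_imp_inj_on) (simp_all add: cells_def)
    with img show ?thesis by (simp add: orthogonal_squares_def bij_betw_def)
  qed
  ultimately show ?thesis by (simp add: OLS_def A_def B_def)
qed

section \<open>Uniqueness of the normalized pair and the final count\<close>

lemma normalized_OLS_3_eq:
  assumes OLS: "(L, L') \<in> OLS 3"
    and L1: "\<forall>j\<in>{1..3}. L (1, j) = j" and L1': "\<forall>j\<in>{1..3}. L' (1, j) = j"
    and L21: "L (2, 1) = 2"
  shows "(L, L') = (cyclic_square 3 (cycle_of_list [1, 2, 3]), cyclic_square 3 (cycle_of_list [1, 3, 2]))"
proof -
  have lat: "L \<in> latin_squares 3" "L' \<in> latin_squares 3"
    using OLS by (auto simp: OLS_def)
  have three: "x = 1 \<or> x = 2 \<or> x = 3" if "x \<in> {1..3}" for x :: nat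
    using that by auto
  have mem: "M (i, j) \<in> {1..3}" if "M \<in> {L, L'}" "i \<in> {1..3}" "j \<in> {1..3}" for M i j
    using that lat latin_square_mem by blast
  have row: "M (i, j) \<noteq> M (i, j')"
    if "M \<in> {L, L'}" "i \<in> {1..3}" "j \<in> {1..3}" "j' \<in> {1..3}" "j \<noteq> j'" for M i j j'
    using that lat latin_square_row_eq_iff by blast
  have col: "M (i, j) \<noteq> M (i', j)"
    if "M \<in> {L, L'}" "i \<in> {1..3}" "i' \<in> {1..3}" "j \<in> {1..3}" "i \<noteq> i'" for M i i' j
    using that lat latin_square_col_eq_iff by blast
  have first: "M (1, 1) = 1" "M (1, 2) = 2" "M (1, 3) = 3" if "M \<in> {L, L'}" for M
    using that L1 L1' by auto
  have neq: "L (i, j) \<noteq> L' (i, j)" if "i \<in> {2, 3}" "j \<in> {1..3}" for i j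
    using orthogonal_normalized_disagree[OF OLS L1 L1'] that by auto
  \<comment> \<open>Row 2 already uses the symbol 2 and column 3 already uses 3; this cell decides
    the rest of row 2.\<close>
  have L23: "L (2, 3) = 1"
    using three[OF mem[of L 2 3]] row[of L 2 1 3] col[of L 1 2 3] first[of L] L21 by auto
  have L22: "L (2, 2) = 3"
    using three[OF mem[of L 2 2]] row[of L 2 1 2] row[of L 2 2 3] L21 L23 by auto
  \<comment> \<open>Each column has one symbol left for row 3.\<close>
  have L3: "L (3, 1) = 3" "L (3, 2) = 1" "L (3, 3) = 2"
    using three[OF mem[of L 3 1]] three[OF mem[of L 3 2]] three[OF mem[of L 3 3]]
      col[of L 1 3 1] col[of L 2 3 1] col[of L 1 3 2] col[of L 2 3 2] col[of L 1 3 3]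
      col[of L 2 3 3] first[of L] L21 L22 L23 by auto
  \<comment> \<open>At each cell two different symbols are excluded: the top entry \<open>j\<close>
    of the column, and the entry of \<open>L\<close> there, which differs from \<open>j\<close> as
    \<open>L\<close> also has \<open>j\<close> on top. The third symbol remains.\<close>
  have L': "L' (2, 1) = 3" "L' (2, 2) = 1" "L' (2, 3) = 2"
     "L' (3, 1) = 2" "L' (3, 2) = 3" "L' (3, 3) = 1"
    using three[OF mem[of L' 2 1]] three[OF mem[of L' 2 2]] three[OF mem[of L' 2 3]]
      three[OF mem[of L' 3 1]] three[OF mem[of L' 3 2]] three[OF mem[of L' 3 3]]
      col[of L' 1 2 1] col[of L' 1 2 2] col[of L' 1 2 3]
      col[of L' 1 3 1] col[of L' 1 3 2] col[of L' 1 3 3]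
      neq[of 2 1] neq[of 2 2] neq[of 2 3] neq[of 3 1] neq[of 3 2] neq[of 3 3]
      first[of L'] L21 L22 L23 L3 by auto
  have "L = cyclic_square 3 (cycle_of_list [1, 2, 3])"
  proof (rule extensionalityI[OF latin_square_ext[OF lat(1)] cyclic_square_123(1)])
    fix c assume "c \<in> cells 3"
    then show "L c = cyclic_square 3 (cycle_of_list [1, 2, 3]) c"
      unfolding cells_def atLeastAtMost_1_3
      using first[of L] L21 L22 L23 L3 cyclic_square_123(2-) by fastforce
  qed
  moreover have "L' = cyclic_square 3 (cycle_of_list [1, 3, 2])"
  proof (rule extensionalityI[OF latin_square_ext[OF lat(2)] cyclic_square_132(1)])
    fix c assume "c \<in> cells 3"
    then show "L' c = cyclic_square 3 (cycle_of_list [1, 3, 2]) c"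
      unfolding cells_def atLeastAtMost_1_3
      using first[of L'] L' cyclic_square_132(2-) by fastforce
  qed
  ultimately show ?thesis by simp
qed

lemma OLS_3_equiv_cyclic_pair:
  assumes "p \<in> OLS 3"
  shows "(p, (cyclic_square 3 (cycle_of_list [1, 2, 3]), cyclic_square 3 (cycle_of_list [1, 3, 2])))
    \<in> ols_equiv 3"
proof -
  obtain L L' where p: "p = (L, L')" by fastforce
  obtain M M' where M: "(p, (M, M')) \<in> ols_equiv 3"
    "\<forall>j\<in>{1..3}. M (1, j) = j" "\<forall>j\<in>{1..3}. M' (1, j) = j"
    using normalize_first_rows assms unfolding p by blast
  have MO: "(M, M') \<in> OLS 3" by (rule ols_equiv_mem[OF M(1)])
  then have lat: "M \<in> latin_squares 3" by (simp add: OLS_def)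
  show ?thesis
  proof (cases "M (2, 1) = 2")
    case True
    then show ?thesis using normalized_OLS_3_eq[OF MO M(2,3)] M(1) by simp
  next
    case False
    \<comment> \<open>Column 1 has 1 on top, so the symbol 2 missing from row 2 must stand in row
      3.\<close>
    have M31: "M (3, 1) = 2"
      using False M(2) latin_square_mem[OF lat, of 2 1] latin_square_mem[OF lat, of 3 1]
        latin_square_col_eq_iff[OF lat, of 1 2 1] latin_square_col_eq_iff[OF lat, of 1 3 1]
        latin_square_col_eq_iff[OF lat, of 2 3 1] by auto
    let ?N = "swap_rows 3 2 3 M" and ?N' = "swap_rows 3 2 3 M'"
    have "((M, M'), (?N, ?N')) \<in> ols_equiv 3"
      by (rule ols_equiv_swap_rows[OF MO]) auto
    then have N: "(p, (?N, ?N')) \<in> ols_equiv 3"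
      using M(1) ols_equiv_trans by blast
    have "(?N, ?N') = (cyclic_square 3 (cycle_of_list [1, 2, 3]),
        cyclic_square 3 (cycle_of_list [1, 3, 2]))"
      \<comment> \<open>Exchanging rows 2 and 3 leaves row 1 alone, so both first rows remain
        normalized.\<close>
      using M(2,3) M31
      by (intro normalized_OLS_3_eq[OF ols_equiv_mem[OF N]])
        (auto simp: swap_rows_apply Transposition.transpose_def)
    with N show ?thesis by simp
  qed
qed

theorem theorem3p4:
  "(cyclic_square 3 (cycle_of_list [1, 2, 3]), cyclic_square 3 (cycle_of_list [1, 3, 2])) \<in> OLS 3 \<and>
   (\<forall>p \<in> OLS 3. (p, (cyclic_square 3 (cycle_of_list [1, 2, 3]),
                         cyclic_square 3 (cycle_of_list [1, 3, 2]))) \<in> ols_equiv 3) \<and>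
   card (OLS 3 // ols_equiv 3) = 1"
proof -
  let ?c = "(cyclic_square 3 (cycle_of_list [1, 2, 3]), cyclic_square 3 (cycle_of_list [1, 3, 2]))"
  \<comment> \<open>Every class equals that of \<open>?c\<close>, and this class does occur in the
    quotient because \<open>?c\<close> lies in \<open>OLS 3\<close>.\<close>
  have "OLS 3 // ols_equiv 3 = {ols_equiv 3 `` {?c}}"
    using cyclic_pair_in_OLS OLS_3_equiv_cyclic_pair equiv_class_eq[OF equiv_ols_equiv]
    by (fastforce simp: quotient_def)
  then show ?thesis
    using cyclic_pair_in_OLS OLS_3_equiv_cyclic_pair by simp
qed

end
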